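(* Let $\varphi$ be a formula, $M=\langle W,\succeq,\mathbb{V}\rangle$ a preference model with $M\not\models\varphi$, $rep$ a choice function on the nonempty subsets of $W$, and $\mathfrak{C}=\langle L,\succeq_L,\mathcal{B}\rangle$ a composite construction on $M$. Suppose: (a) for every $v\in\mathit{Fal}(\varphi,M)$ there is a label $b_v\in L$ such that $v\in W(\mathcal{B}(b_v))$, the block $\mathcal{B}(b_v)$ is flat, and $\mathcal{B}(b')$ is (iii)-suitable for $\mathcal{B}(b_v)$ for every $b'\in L$ with $b'\succ_L b_v$; (b) for every $b\in L$ the block $\mathcal{B}(b)$ is either (iv)-safe or (iv)-covered by $\mathcal{B}(b')$ for some $b'\in L$ with $b'\succ_L b$. Then $\mathrm{gen}(\mathfrak{C})\not\models\varphi$.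
   Context: Formulas are built from a set $\mathit{Var}$ of propositional variables by $x\mid\neg\psi\mid\psi_1\wedge\psi_2\mid\Box\psi\mid\mathcal{O}(\psi_1\mid\psi_2)$. $\mathrm{Sub}(\varphi)$ is the set of subformulas of $\varphi$; $\mathrm{Cond}(\varphi)=\{\alpha:\mathcal{O}(\gamma\mid\alpha)\in\mathrm{Sub}(\varphi)\text{ for some }\gamma\}$. A preference model is $M=\langle W,\succeq,\mathbb{V}\rangle$ with $W$ nonempty, $\succeq$ any binary relation on $W$, $\mathbb{V}\colon\mathit{Var}\to\mathcal{P}(W)$. For any binary relation $R$, its strict version is $a\,R^s\,b$ iff $a\,R\,b$ and not $b\,R\,a$; we write $\succ,\succ_L,\succ_U$ for the strict versions of $\succeq,\succeq_L,\succeq_U$. $\max_{\succ}(U)=\{v\in U:\neg\exists u\in U,\ u\succ v\}$; $\mathrm{Bet}(v)=\{w\in W:w\succ v\}$. Truth sets: $\|x\|_M=\mathbb{V}(x)$, $\|\neg\psi\|=W\setminus\|\psi\|$, $\|\psi_1\wedge\psi_2\|=\|\psi_1\|\cap\|\psi_2\|$, $\|\Box\beta\|=W$ if $\|\beta\|=W$ else $\emptyset$, $\|\mathcal{O}(\gamma\mid\alpha)\|=W$ if $\max_\succ(\|\alpha\|)\subseteq\|\gamma\|$ else $\emptyset$. $M,w\models\psi$ iff $w\in\|\psi\|_M$; $M\models\psi$ iff $\|\psi\|_M=W$. For $U\subseteq W$, $\mathrm{SatForm}(M,U)=\{\psi:\exists u\in U,\ M,u\models\psi\}$. $\mathit{Box}^-(\varphi,M)$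 is the set of subformulas $\Box\beta$ of $\varphi$ with $M\not\models\Box\beta$, $\mathit{Ob}^-(\varphi,M)$ the set of subformulas $\mathcal{O}(\gamma\mid\alpha)$ of $\varphi$ with $M\not\models\mathcal{O}(\gamma\mid\alpha)$. A choice function $rep$ assigns to each nonempty $S\subseteq W$ some $rep(S)\in S$. Falsifying worlds: $\mathit{Fal}(\varphi,M)=\{rep(W\setminus\|\varphi\|)\}\cup\{rep(W\setminus\|\beta\|):\Box\beta\in\mathit{Box}^-(\varphi,M)\}\cup\{rep(\max_\succ(\|\alpha\|)\setminus\|\gamma\|):\mathcal{O}(\gamma\mid\alpha)\in\mathit{Ob}^-(\varphi,M)\}$. A block on $M$ is a pair $B=\langle U,\succeq_U\rangle$ with $U\subseteq W$ and $\succeq_U$ a binary relation on $U$; $W(B)=U$. A composite construction on $M$ is $\langle L,\succeq_L,\mathcal{B}\rangle$ where $L$ is a set of labels, $\succeq_L$ a binary relation on $L$, and $\mathcal{B}$ maps each label to a block on $M$. It generates the model $\mathrm{gen}(\mathfrak{C})=\langle W^{gen},\succeq^{gen},\mathbb{V}^{gen}\rangle$ with $W^{gen}=\{(l,w):l\in L,w\in W(\mathcal{B}(l))\}$; $(l_1,w_1)\succeq^{gen}(l_2,w_2)$ iff $l_1\succeq_L l_2$, or $l_1=l_2$ and $w_1\succeq_U w_2$ where $\mathcal{B}(l_1)=\langle U,\succeq_U\rangle$; $(l,w)\in\mathbb{V}^{gen}(x)$ iff $w\in\mathbb{V}(x)$. Block properties (relative to $M,\varphi$): $\langle U,\succeq_U\rangle$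 is flat if there are no $w_1,w_2\in U$ with $w_1\succ_U w_2$; $B'$ is (iii)-suitable for $B$ if $W(B')\subseteq\mathrm{Bet}(w)$ for every $w\in W(B)$; $\langle U,\succeq_U\rangle$ is (iv)-safe if for every $w\in U$ and every $\alpha\in\mathrm{SatForm}(M,\mathrm{Bet}(w))\cap\mathrm{Cond}(\varphi)$ there is $w'\in U$ with $w'\succ_U w$ and $M,w'\models\alpha$; $B'$ (iv)-covers $B$ if $\mathrm{SatForm}(M,\mathrm{Bet}(w))\cap\mathrm{Cond}(\varphi)\subseteq\mathrm{SatForm}(M,W(B'))$ for every $w\in W(B)$.
   Formalization: Added hypothesis: for every label b with b ⪰_L b, the block B(b) is flat or is (iv)-covered by B(b') for some b' ≻_L b. Without it the claim fails, since a reflexive label makes all worlds of its block mutually related in gen(C). *)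

theory Defs
  imports Main
begin

datatype 'x form =
    Atom 'x
  | Neg "'x form"
  | Conj "'x form" "'x form"
  | Box "'x form"
  | Ob "'x form" "'x form"  (* Ob \<gamma> \<alpha> is the conditional obligation O(\<gamma> | \<alpha>) *)

primrec subforms :: "'x form \<Rightarrow> 'x form set" where
  "subforms (Atom x) = {Atom x}"
| "subforms (Neg \<psi>) = insert (Neg \<psi>) (subforms \<psi>)"
| "subforms (Conj \<psi>\<^sub>1 \<psi>\<^sub>2) = insert (Conj \<psi>\<^sub>1 \<psi>\<^sub>2) (subforms \<psi>\<^sub>1 \<union> subforms \<psi>\<^sub>2)"
| "subforms (Box \<psi>) = insert (Box \<psi>) (subforms \<psi>)"
| "subforms (Ob \<psi>\<^sub>1 \<psi>\<^sub>2) = insert (Ob \<psi>\<^sub>1 \<psi>\<^sub>2) (subforms \<psi>\<^sub>1 \<union> subforms \<psi>\<^sub>2)"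

definition Cond :: "'x form \<Rightarrow> 'x form set" where
  "Cond \<phi> = {\<alpha>. \<exists>\<gamma>. Ob \<gamma> \<alpha> \<in> subforms \<phi>}"

definition strict :: "'a rel \<Rightarrow> 'a rel" where
  "strict R = {(a, b). (a, b) \<in> R \<and> (b, a) \<notin> R}"

record ('w, 'x) model =
  worlds :: "'w set"
  pref :: "'w rel"
  val :: "'x \<Rightarrow> 'w set"

definition pref_model :: "('w, 'x) model \<Rightarrow> bool" where
  "pref_model M \<longleftrightarrow> worlds M \<noteq> {} \<and> pref M \<subseteq> worlds M \<times> worlds M \<and> (\<forall>x. val M x \<subseteq> worlds M)"

(* (a, b) \<in> pref M reads "a is at least as good as b"; maximality is with respect to
   the strict version of the relation. *)
definition max_worlds :: "('w, 'x) model \<Rightarrow> 'w set \<Rightarrow> 'w set" where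
  "max_worlds M U = {v \<in> U. \<not> (\<exists>u\<in>U. (u, v) \<in> strict (pref M))}"

definition Bet :: "('w, 'x) model \<Rightarrow> 'w \<Rightarrow> 'w set" where
  "Bet M v = {w \<in> worlds M. (w, v) \<in> strict (pref M)}"

primrec truth :: "('w, 'x) model \<Rightarrow> 'x form \<Rightarrow> 'w set" where
  "truth M (Atom x) = val M x"
| "truth M (Neg \<psi>) = worlds M - truth M \<psi>"
| "truth M (Conj \<psi>\<^sub>1 \<psi>\<^sub>2) = truth M \<psi>\<^sub>1 \<inter> truth M \<psi>\<^sub>2"
| "truth M (Box \<beta>) = (if truth M \<beta> = worlds M then worlds M else {})"
| "truth M (Ob \<gamma> \<alpha>) = (if max_worlds M (truth M \<alpha>) \<subseteq> truth M \<gamma> then worlds M else {})"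

definition sat :: "('w, 'x) model \<Rightarrow> 'w \<Rightarrow> 'x form \<Rightarrow> bool" where
  "sat M w \<psi> \<longleftrightarrow> w \<in> truth M \<psi>"

definition valid_in :: "('w, 'x) model \<Rightarrow> 'x form \<Rightarrow> bool" where
  "valid_in M \<psi> \<longleftrightarrow> truth M \<psi> = worlds M"

definition SatForm :: "('w, 'x) model \<Rightarrow> 'w set \<Rightarrow> 'x form set" where
  "SatForm M U = {\<psi>. \<exists>u\<in>U. sat M u \<psi>}"

definition Box_minus :: "'x form \<Rightarrow> ('w, 'x) model \<Rightarrow> 'x form set" where
  "Box_minus \<phi> M = {Box \<beta> | \<beta>. Box \<beta> \<in> subforms \<phi> \<and> \<not> valid_in M (Box \<beta>)}"

definition Ob_minus :: "'x form \<Rightarrow> ('w, 'x) model \<Rightarrow> 'x form set" where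
  "Ob_minus \<phi> M = {Ob \<gamma> \<alpha> | \<gamma> \<alpha>. Ob \<gamma> \<alpha> \<in> subforms \<phi> \<and> \<not> valid_in M (Ob \<gamma> \<alpha>)}"

definition choice_function_on :: "'w set \<Rightarrow> ('w set \<Rightarrow> 'w) \<Rightarrow> bool" where
  "choice_function_on W rep \<longleftrightarrow> (\<forall>S. S \<subseteq> W \<and> S \<noteq> {} \<longrightarrow> rep S \<in> S)"

definition Fal :: "('w set \<Rightarrow> 'w) \<Rightarrow> 'x form \<Rightarrow> ('w, 'x) model \<Rightarrow> 'w set" where
  "Fal rep \<phi> M =
     {rep (worlds M - truth M \<phi>)}
     \<union> {rep (worlds M - truth M \<beta>) | \<beta>. Box \<beta> \<in> Box_minus \<phi> M}
     \<union> {rep (max_worlds M (truth M \<alpha>) - truth M \<gamma>) | \<gamma> \<alpha>. Ob \<gamma> \<alpha> \<in> Ob_minus \<phi> M}"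

record 'w block =
  bworlds :: "'w set"
  bpref :: "'w rel"

definition block_on :: "('w, 'x) model \<Rightarrow> 'w block \<Rightarrow> bool" where
  "block_on M B \<longleftrightarrow> bworlds B \<subseteq> worlds M \<and> bpref B \<subseteq> bworlds B \<times> bworlds B"

record ('l, 'w) construction =
  labels :: "'l set"
  lpref :: "'l rel"
  blk :: "'l \<Rightarrow> 'w block"

definition construction_on :: "('w, 'x) model \<Rightarrow> ('l, 'w) construction \<Rightarrow> bool" where
  "construction_on M C \<longleftrightarrow>
     lpref C \<subseteq> labels C \<times> labels C \<and> (\<forall>l\<in>labels C. block_on M (blk C l))"

(* When (l, l) \<in> lpref C, the first disjunct relates all worlds carrying the label l in both
   directions, so no two of them are strictly related, whatever bpref (blk C l) is. *)
definition gen :: "('w, 'x) model \<Rightarrow> ('l, 'w) construction \<Rightarrow> ('l \<times> 'w, 'x) model" where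
  "gen M C =
    (let Wgen = {(l, w). l \<in> labels C \<and> w \<in> bworlds (blk C l)} in
     \<lparr> worlds = Wgen,
       pref = {((l\<^sub>1, w\<^sub>1), (l\<^sub>2, w\<^sub>2)).
                 (l\<^sub>1, w\<^sub>1) \<in> Wgen \<and> (l\<^sub>2, w\<^sub>2) \<in> Wgen \<and>
                 ((l\<^sub>1, l\<^sub>2) \<in> lpref C \<or> l\<^sub>1 = l\<^sub>2 \<and> (w\<^sub>1, w\<^sub>2) \<in> bpref (blk C l\<^sub>1))},
       val = (\<lambda>x. {(l, w). (l, w) \<in> Wgen \<and> w \<in> val M x}) \<rparr>)"

definition flat :: "'w block \<Rightarrow> bool" where
  "flat B \<longleftrightarrow> \<not> (\<exists>w\<^sub>1\<in>bworlds B. \<exists>w\<^sub>2\<in>bworlds B. (w\<^sub>1, w\<^sub>2) \<in> strict (bpref B))"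

definition iii_suitable :: "('w, 'x) model \<Rightarrow> 'w block \<Rightarrow> 'w block \<Rightarrow> bool" where
  "iii_suitable M B' B \<longleftrightarrow> (\<forall>w\<in>bworlds B. bworlds B' \<subseteq> Bet M w)"

definition iv_safe :: "('w, 'x) model \<Rightarrow> 'x form \<Rightarrow> 'w block \<Rightarrow> bool" where
  "iv_safe M \<phi> B \<longleftrightarrow>
     (\<forall>w\<in>bworlds B. \<forall>\<alpha> \<in> SatForm M (Bet M w) \<inter> Cond \<phi>.
        \<exists>w'\<in>bworlds B. (w', w) \<in> strict (bpref B) \<and> sat M w' \<alpha>)"

definition iv_covers :: "('w, 'x) model \<Rightarrow> 'x form \<Rightarrow> 'w block \<Rightarrow> 'w block \<Rightarrow> bool" where
  "iv_covers M \<phi> B' B \<longleftrightarrow>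
     (\<forall>w\<in>bworlds B. SatForm M (Bet M w) \<inter> Cond \<phi> \<subseteq> SatForm M (bworlds B'))"

end

theory Submission
  imports Defs
begin

text \<open>
  By induction, every subformula \<open>\<psi>\<close> of \<open>\<phi>\<close> holds at \<open>(l, w)\<close> in \<open>gen M C\<close> iff it holds at
  \<open>w\<close> in \<open>M\<close>. For an obligation that holds in \<open>M\<close>, condition (b) makes maximality in \<open>gen M C\<close>
  imply maximality in \<open>M\<close>. For one that fails in \<open>M\<close>, condition (a) keeps its falsifying world
  maximal in \<open>gen M C\<close>. The falsifying world of \<open>\<phi>\<close> itself then refutes \<open>\<phi>\<close>.
\<close>

lemma subforms_refl: "\<psi> \<in> subforms \<psi>"
  by (cases \<psi>) auto

lemma subforms_trans: "\<psi> \<in> subforms \<phi> \<Longrightarrow> \<chi> \<in> subforms \<psi> \<Longrightarrow> \<chi> \<in> subforms \<phi>"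
  by (induction \<phi>) auto

lemma truth_subset_worlds: "pref_model M \<Longrightarrow> truth M \<psi> \<subseteq> worlds M"
  by (induction \<psi>) (auto simp: pref_model_def)

text \<open>Since \<open>worlds M\<close> is nonempty, the two possible truth sets
  \<open>worlds M\<close> and \<open>{}\<close> are distinct, so validity decides the test in the
  \<open>if\<close>. The same holds for \<open>Ob\<close> below.\<close>

lemma valid_in_Box_iff:
  "pref_model M \<Longrightarrow> valid_in M (Box \<beta>) \<longleftrightarrow> truth M \<beta> = worlds M"
  by (auto simp: valid_in_def pref_model_def)

lemma valid_in_Ob_iff:
  "pref_model M \<Longrightarrow> valid_in M (Ob \<gamma> \<alpha>) \<longleftrightarrow> max_worlds M (truth M \<alpha>) \<subseteq> truth M \<gamma>"
  by (auto simp: valid_in_def pref_model_def)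

text \<open>\<open>Fal\<close> collects values of \<open>rep\<close> on three kinds of sets. This
  turns such a value into a world of the set itself, so the next three lemmas only have to check
  their particular set \<open>S\<close>.\<close>

lemma rep_Fal_witness:
  assumes "choice_function_on (worlds M) rep" and "S \<subseteq> worlds M" and "S \<noteq> {}"
    and "rep S \<in> Fal rep \<phi> M"
  obtains v where "v \<in> S" and "v \<in> Fal rep \<phi> M"
  using assms unfolding choice_function_on_def by blast

lemma Fal_witness:
  assumes "pref_model M" and "choice_function_on (worlds M) rep" and "\<not> valid_in M \<phi>"
  obtains v where "v \<in> Fal rep \<phi> M" and "v \<in> worlds M" and "v \<notin> truth M \<phi>"
proof (rule rep_Fal_witness[OF assms(2), of "worlds M - truth M \<phi>" \<phi>])
  show "worlds M - truth M \<phi> \<noteq> {}"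
    using assms(3) truth_subset_worlds[OF assms(1), of \<phi>] by (auto simp: valid_in_def)
qed (use that in \<open>auto simp: Fal_def\<close>)

lemma Fal_witness_Box:
  assumes "pref_model M" and "choice_function_on (worlds M) rep"
    and "Box \<beta> \<in> subforms \<phi>" and "truth M \<beta> \<noteq> worlds M"
  obtains v where "v \<in> Fal rep \<phi> M" and "v \<in> worlds M" and "v \<notin> truth M \<beta>"
proof (rule rep_Fal_witness[OF assms(2), of "worlds M - truth M \<beta>" \<phi>])
  show "worlds M - truth M \<beta> \<noteq> {}"
    using assms(4) truth_subset_worlds[OF assms(1), of \<beta>] by auto
  have "Box \<beta> \<in> Box_minus \<phi> M"
    using assms by (simp add: Box_minus_def valid_in_Box_iff)
  then show "rep (worlds M - truth M \<beta>) \<in> Fal rep \<phi> M"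
    unfolding Fal_def by blast
qed (use that in auto)

lemma Fal_witness_Ob:
  assumes "pref_model M" and "choice_function_on (worlds M) rep"
    and "Ob \<gamma> \<alpha> \<in> subforms \<phi>" and "\<not> max_worlds M (truth M \<alpha>) \<subseteq> truth M \<gamma>"
  obtains v where "v \<in> Fal rep \<phi> M" and "v \<in> max_worlds M (truth M \<alpha>)" and "v \<notin> truth M \<gamma>"
proof (rule rep_Fal_witness[OF assms(2), of "max_worlds M (truth M \<alpha>) - truth M \<gamma>" \<phi>])
  show "max_worlds M (truth M \<alpha>) - truth M \<gamma> \<subseteq> worlds M"
    using truth_subset_worlds[OF assms(1), of \<alpha>] by (auto simp: max_worlds_def)
  have "Ob \<gamma> \<alpha> \<in> Ob_minus \<phi> M"
    using assms by (simp add: Ob_minus_def valid_in_Ob_iff)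
  then show "rep (max_worlds M (truth M \<alpha>) - truth M \<gamma>) \<in> Fal rep \<phi> M"
    unfolding Fal_def by blast
qed (use that assms(4) in auto)

lemma worlds_gen_iff [simp]:
  "(l, w) \<in> worlds (gen M C) \<longleftrightarrow> l \<in> labels C \<and> w \<in> bworlds (blk C l)"
  by (simp add: gen_def Let_def)

lemma val_gen_iff [simp]:
  "(l, w) \<in> val (gen M C) x \<longleftrightarrow> (l, w) \<in> worlds (gen M C) \<and> w \<in> val M x"
  by (simp add: gen_def Let_def)

text \<open>Between distinct labels only \<open>lpref C\<close> counts. Within one label the block
  decides, unless the label is related to itself: then all its worlds are related both ways and
  nothing there is strict.\<close>

lemma strict_pref_gen_iff:
  "((l\<^sub>1, w\<^sub>1), (l\<^sub>2, w\<^sub>2)) \<in> strict (pref (gen M C)) \<longleftrightarrow>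
     (l\<^sub>1, w\<^sub>1) \<in> worlds (gen M C) \<and> (l\<^sub>2, w\<^sub>2) \<in> worlds (gen M C) \<and>
     ((l\<^sub>1, l\<^sub>2) \<in> strict (lpref C) \<or>
      l\<^sub>1 = l\<^sub>2 \<and> (l\<^sub>1, l\<^sub>1) \<notin> lpref C \<and> (w\<^sub>1, w\<^sub>2) \<in> strict (bpref (blk C l\<^sub>1)))"
  by (auto simp: gen_def Let_def strict_def)

text \<open>If \<open>w\<close> were not maximal in \<open>M\<close>, some \<alpha>-world would be
  better than \<open>w\<close>, so \<alpha> is one of the formulas that (b) speaks of. A covering
  block at a strictly higher label, or the safe block itself, then has an \<alpha>-world whose copy
  is strictly better than \<open>(l, w)\<close>. Assumption \<open>refl\<close> ensures that the
  strictness inside a safe block survives in \<open>gen M C\<close>.\<close>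

lemma max_worlds_gen_imp_max_worlds:
  assumes model: "pref_model M"
    and lift: "\<And>l w. (l, w) \<in> truth (gen M C) \<alpha> \<longleftrightarrow> (l, w) \<in> worlds (gen M C) \<and> w \<in> truth M \<alpha>"
    and cond: "\<alpha> \<in> Cond \<phi>"
    and b: "iv_safe M \<phi> (blk C l) \<or>
        (\<exists>b'\<in>labels C. (b', l) \<in> strict (lpref C) \<and> iv_covers M \<phi> (blk C b') (blk C l))"
    and refl: "(l, l) \<in> lpref C \<Longrightarrow> flat (blk C l) \<or>
        (\<exists>b'\<in>labels C. (b', l) \<in> strict (lpref C) \<and> iv_covers M \<phi> (blk C b') (blk C l))"
    and max: "(l, w) \<in> max_worlds (gen M C) (truth (gen M C) \<alpha>)"
  shows "w \<in> max_worlds M (truth M \<alpha>)"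
proof (rule ccontr)
  assume not_max: "w \<notin> max_worlds M (truth M \<alpha>)"
  have lw: "l \<in> labels C" "w \<in> bworlds (blk C l)" "w \<in> truth M \<alpha>"
    using max by (auto simp: max_worlds_def lift)
  have no_better: "((l', w'), (l, w)) \<notin> strict (pref (gen M C))"
    if "l' \<in> labels C" "w' \<in> bworlds (blk C l')" "w' \<in> truth M \<alpha>" for l' w'
    using max that by (auto simp: max_worlds_def lift)
  obtain u where "u \<in> truth M \<alpha>" "(u, w) \<in> strict (pref M)"
    using not_max lw(3) by (auto simp: max_worlds_def)
  then have sat_Bet: "\<alpha> \<in> SatForm M (Bet M w) \<inter> Cond \<phi>"
    using cond truth_subset_worlds[OF model, of \<alpha>] by (auto simp: SatForm_def Bet_def sat_def)
  show False
  \<comment> \<open>Covering is the alternative shared by \<open>b\<close> and \<open>refl\<close>;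
    its failure leaves safety from the former and, for a self-related label, flatness from the
    latter.\<close>
  proof (cases "\<exists>b'\<in>labels C. (b', l) \<in> strict (lpref C) \<and> iv_covers M \<phi> (blk C b') (blk C l)")
    case True
    then obtain b' w' where "b' \<in> labels C" "(b', l) \<in> strict (lpref C)"
      "w' \<in> bworlds (blk C b')" "w' \<in> truth M \<alpha>"
      using sat_Bet lw(2) unfolding iv_covers_def SatForm_def sat_def by blast
    then show False
      using no_better lw by (auto simp: strict_pref_gen_iff)
  next
    case False
    then obtain w' where w': "w' \<in> bworlds (blk C l)" "(w', w) \<in> strict (bpref (blk C l))"
      "w' \<in> truth M \<alpha>"
      using b sat_Bet lw(2) unfolding iv_safe_def sat_def by blast
    \<comment> \<open>The strict pair \<open>(w', w)\<close> shows that the block is not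
      flat.\<close>
    have "(l, l) \<notin> lpref C"
      using refl False w' lw(2) unfolding flat_def by blast
    then show False
      using no_better lw w' by (auto simp: strict_pref_gen_iff)
  qed
qed

text \<open>A flat block has no strict pair of its own, so a world strictly better than
  \<open>(b, v)\<close> carries a strictly higher label. Suitability puts its second component into
  \<open>Bet M v\<close>, and by maximality of \<open>v\<close> it cannot satisfy \<alpha>.\<close>

lemma max_worlds_imp_max_worlds_gen:
  assumes lift: "\<And>l w. (l, w) \<in> truth (gen M C) \<alpha> \<longleftrightarrow> (l, w) \<in> worlds (gen M C) \<and> w \<in> truth M \<alpha>"
    and max: "v \<in> max_worlds M (truth M \<alpha>)"
    and b: "b \<in> labels C" "v \<in> bworlds (blk C b)" "flat (blk C b)"
    and suitable: "\<And>b'. b' \<in> labels C \<Longrightarrow> (b', b) \<in> strict (lpref C) \<Longrightarrow>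
        iii_suitable M (blk C b') (blk C b)"
  shows "(b, v) \<in> max_worlds (gen M C) (truth (gen M C) \<alpha>)"
proof -
  have "((l, w), (b, v)) \<notin> strict (pref (gen M C))"
    if lw: "l \<in> labels C" "w \<in> bworlds (blk C l)" "w \<in> truth M \<alpha>" for l w
  proof
    assume "((l, w), (b, v)) \<in> strict (pref (gen M C))"
    then have "(l, b) \<in> strict (lpref C)"
      using b(2,3) by (auto simp: strict_pref_gen_iff flat_def)
    then have "w \<in> Bet M v"
      using suitable lw b(2) unfolding iii_suitable_def by blast
    then show False
      using max lw(3) by (auto simp: max_worlds_def Bet_def)
  qed
  then show ?thesis
    using max b by (auto simp: max_worlds_def lift)
qed

text \<open>\<open>a\<close> and \<open>b\<close> are the conditions (a) and (b);
  \<open>refl_labels\<close> is a further condition on self-related labels. At such a label the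
  generated model erases the strict preferences of the block, so the better worlds promised by
  safety would be lost. It holds trivially when \<open>lpref C\<close> is irreflexive.\<close>

theorem theorem3p7:
  fixes \<phi> :: "'x form"
    and M :: "('w, 'x) model"
    and rep :: "'w set \<Rightarrow> 'w"
    and C :: "('l, 'w) construction"
  assumes model: "pref_model M"
    and falsified: "\<not> valid_in M \<phi>"
    and choice: "choice_function_on (worlds M) rep"
    and constr: "construction_on M C"
    and a: "\<And>v. v \<in> Fal rep \<phi> M \<Longrightarrow>
        \<exists>b\<in>labels C. v \<in> bworlds (blk C b) \<and> flat (blk C b) \<and>
          (\<forall>b'\<in>labels C. (b', b) \<in> strict (lpref C) \<longrightarrow> iii_suitable M (blk C b') (blk C b))"
    and b: "\<And>b. b \<in> labels C \<Longrightarrow>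
        iv_safe M \<phi> (blk C b) \<or>
        (\<exists>b'\<in>labels C. (b', b) \<in> strict (lpref C) \<and> iv_covers M \<phi> (blk C b') (blk C b))"
    and refl_labels: "\<And>b. b \<in> labels C \<Longrightarrow> (b, b) \<in> lpref C \<Longrightarrow>
        flat (blk C b) \<or>
        (\<exists>b'\<in>labels C. (b', b) \<in> strict (lpref C) \<and> iv_covers M \<phi> (blk C b') (blk C b))"
  shows "\<not> valid_in (gen M C) \<phi>"
proof
  have gen_worlds: "w \<in> worlds M" if "(l, w) \<in> worlds (gen M C)" for l w
    using that constr by (auto simp: construction_on_def block_on_def)
  \<comment> \<open>The restriction to subformulas of \<phi> is what makes \<open>Fal\<close> and
    \<open>Cond\<close> applicable. The pair stays arbitrary because the modal cases compare whole
    truth sets.\<close>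
  have gen_iff: "(l, w) \<in> truth (gen M C) \<psi> \<longleftrightarrow> (l, w) \<in> worlds (gen M C) \<and> w \<in> truth M \<psi>"
    if "\<psi> \<in> subforms \<phi>" for \<psi> l w
    using that
  proof (induction \<psi> arbitrary: l w)
    case (Atom x)
    then show ?case by simp
  next
    case (Neg \<psi>)
    have "\<psi> \<in> subforms \<phi>"
      using subforms_trans[OF Neg.prems] by (simp add: subforms_refl)
    then show ?case using Neg.IH gen_worlds by auto
  next
    case (Conj \<psi>\<^sub>1 \<psi>\<^sub>2)
    have "\<psi>\<^sub>1 \<in> subforms \<phi>" "\<psi>\<^sub>2 \<in> subforms \<phi>"
      using subforms_trans[OF Conj.prems] by (simp_all add: subforms_refl)
    then show ?case using Conj.IH by auto
  next
    case (Box \<beta>)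
    have "\<beta> \<in> subforms \<phi>"
      using subforms_trans[OF Box.prems] by (simp add: subforms_refl)
    note IH = Box.IH[OF this]
    have "truth (gen M C) \<beta> = worlds (gen M C) \<longleftrightarrow> truth M \<beta> = worlds M"
    proof
      assume "truth M \<beta> = worlds M"
      then show "truth (gen M C) \<beta> = worlds (gen M C)"
        using IH gen_worlds by auto
    next
      assume gen_valid: "truth (gen M C) \<beta> = worlds (gen M C)"
      show "truth M \<beta> = worlds M"
      proof (rule ccontr)
        assume "truth M \<beta> \<noteq> worlds M"
        then obtain v where "v \<in> Fal rep \<phi> M" "v \<notin> truth M \<beta>"
          using Fal_witness_Box[OF model choice Box.prems] by blast
        \<comment> \<open>By (a) the falsifying world \<open>v\<close> has a copy in
          \<open>gen M C\<close>, where \<beta> fails by the induction hypothesis.\<close>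
        then show False
          using a[of v] gen_valid IH by auto
      qed
    qed
    then show ?case using gen_worlds by auto
  next
    case (Ob \<gamma> \<alpha>)
    have "\<gamma> \<in> subforms \<phi>" "\<alpha> \<in> subforms \<phi>"
      using subforms_trans[OF Ob.prems] by (simp_all add: subforms_refl)
    note IH = Ob.IH(1)[OF this(1)] Ob.IH(2)[OF this(2)]
    have cond: "\<alpha> \<in> Cond \<phi>"
      using Ob.prems by (auto simp: Cond_def)
    have "max_worlds (gen M C) (truth (gen M C) \<alpha>) \<subseteq> truth (gen M C) \<gamma> \<longleftrightarrow>
        max_worlds M (truth M \<alpha>) \<subseteq> truth M \<gamma>"
    proof
      assume valid: "max_worlds M (truth M \<alpha>) \<subseteq> truth M \<gamma>"
      show "max_worlds (gen M C) (truth (gen M C) \<alpha>) \<subseteq> truth (gen M C) \<gamma>"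
      proof clarify
        fix l w
        assume max: "(l, w) \<in> max_worlds (gen M C) (truth (gen M C) \<alpha>)"
        then have gen: "(l, w) \<in> worlds (gen M C)"
          by (simp add: max_worlds_def IH(2))
        then have "w \<in> max_worlds M (truth M \<alpha>)"
          using max_worlds_gen_imp_max_worlds[OF model IH(2) cond b refl_labels max] by simp
        then show "(l, w) \<in> truth (gen M C) \<gamma>"
          using valid gen IH(1) by auto
      qed
    next
      assume gen_valid: "max_worlds (gen M C) (truth (gen M C) \<alpha>) \<subseteq> truth (gen M C) \<gamma>"
      show "max_worlds M (truth M \<alpha>) \<subseteq> truth M \<gamma>"
      proof (rule ccontr)
        assume "\<not> max_worlds M (truth M \<alpha>) \<subseteq> truth M \<gamma>"
        then obtain v where v: "v \<in> Fal rep \<phi> M" "v \<in> max_worlds M (truth M \<alpha>)" "v \<notin> truth M \<gamma>"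
          using Fal_witness_Ob[OF model choice Ob.prems] by blast
        \<comment> \<open>An arbitrary copy of \<open>v\<close> need not be maximal in
          \<open>gen M C\<close>; the label has to be the one that (a) provides.\<close>
        obtain l where "l \<in> labels C" "v \<in> bworlds (blk C l)" "flat (blk C l)"
          "\<And>b'. b' \<in> labels C \<Longrightarrow> (b', l) \<in> strict (lpref C) \<Longrightarrow>
             iii_suitable M (blk C b') (blk C l)"
          using a[OF v(1)] by blast
        from max_worlds_imp_max_worlds_gen[OF IH(2) v(2) this] show False
          using gen_valid IH(1) v(3) by auto
      qed
    qed
    then show ?case using gen_worlds by auto
  qed
  assume gen_valid: "valid_in (gen M C) \<phi>"
  obtain v where "v \<in> Fal rep \<phi> M" "v \<notin> truth M \<phi>"
    using Fal_witness[OF model choice falsified] by blast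
  moreover from a[OF this(1)] obtain l where "(l, v) \<in> worlds (gen M C)"
    by auto
  ultimately show False
    using gen_valid gen_iff[OF subforms_refl] by (auto simp: valid_in_def)
qed

end
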